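(* Let $n>1$ be an odd positive integer. Then \[ \sum_{k=0}^{\frac{n+1}2}[4k-1]\frac{(q^{-1};q^2)_k^4}{(q^2;q^2)_k^4} q^{4k} \equiv -(1+3q+q^2)[n]^4 \pmod{[n]^4\Phi_n(q)}, \] and \[ \sum_{k=0}^{n-1}[4k-1]\frac{(q^{-1};q^2)_k^4}{(q^2;q^2)_k^4} q^{4k} \equiv -(1+3q+q^2)[n]^4 \pmod{[n]^4\Phi_n(q)}. \]
   Context: Here $q$ is an indeterminate. The $q$-shifted factorial is $(a;q)_k=(1-a)(1-aq)\cdots(1-aq^{k-1})$ (with $(a;q)_0=1$). For an integer $m$, $[m]=[m]_q=\frac{1-q^m}{1-q}$ (so $[m]=1+q+\cdots+q^{m-1}$ for $m\ge 1$, and e.g. $[-1]=-q^{-1}$). $\Phi_n(q)$ denotes the $n$-th cyclotomic polynomial. For rational functions $A,B$ in $q$ and a polynomial $P(q)$, $A\equiv B \pmod{P}$ means that $A-B$ can be written as a quotient of polynomials whose numerator is divisible by $P$ and whose denominator is coprime to $P$. *)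

theory Defs
  imports Complex_Main
    "HOL-Computational_Algebra.Polynomial"
    "HOL-Computational_Algebra.Fraction_Field"
    "HOL-Computational_Algebra.Polynomial_Factorial"
    "HOL-Computational_Algebra.Field_as_Ring"
begin

text \<open>Rational functions in \<open>q\<close> are taken with complex coefficients, so that the cyclotomic
  polynomials can be given by their roots. For rational functions and moduli with rational
  coefficients, divisibility and coprimality of polynomials do not depend on whether the ground
  field is the rationals or the complex numbers.\<close>

type_synonym ratfun = "complex poly fract"

definition qvar :: ratfun where
  "qvar = to_fract [:0, 1:]"

definition qshift :: "'a::comm_ring_1 \<Rightarrow> 'a \<Rightarrow> nat \<Rightarrow> 'a" where
  "qshift a r k = (\<Prod>i<k. 1 - a * r ^ i)"

definition qint :: "int \<Rightarrow> ratfun" where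
  "qint m = (1 - qvar powi m) / (1 - qvar)"

text \<open>For a natural number \<open>n\<close> the rational function \<open>qint n\<close> is a polynomial, which is needed as an
  element of the polynomial ring where it occurs in a modulus; see \<open>to_fract_qint_poly\<close> below.\<close>

definition qint_poly :: "nat \<Rightarrow> complex poly" where
  "qint_poly n = (\<Sum>i<n. monom 1 i)"

definition cyclotomic :: "nat \<Rightarrow> complex poly" where
  "cyclotomic n = (\<Prod>k | 1 \<le> k \<and> k \<le> n \<and> coprime k n. [:- cis (2 * pi * real k / real n), 1:])"

text \<open>The numerator and denominator need not be in lowest terms. The denominator is required to be
  nonzero because \<open>Fract u 0\<close> is \<open>0\<close>, and zero is coprime to a unit modulus.\<close>

definition ratfun_cong :: "ratfun \<Rightarrow> ratfun \<Rightarrow> complex poly \<Rightarrow> bool" where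
  "ratfun_cong A B P \<longleftrightarrow>
     (\<exists>u v. v \<noteq> 0 \<and> A - B = Fract u v \<and> P dvd u \<and> coprime v P)"

lemma to_fract_monom: "to_fract (monom 1 i :: complex poly) = qvar ^ i"
proof (induction i)
  case (Suc i)
  have "(monom 1 (Suc i) :: complex poly) = [:0, 1:] * monom 1 i"
    by (simp add: monom_Suc)
  then show ?case
    using Suc by (simp only: to_fract_mult qvar_def power_Suc)
qed (simp add: qvar_def)

lemma qvar_neq_1: "qvar \<noteq> 1"
proof
  assume "qvar = 1"
  then have "to_fract ([:0, 1:] :: complex poly) = to_fract 1"
    by (simp add: qvar_def)
  then show False
    by (simp add: one_pCons)
qed

lemma to_fract_qint_poly: "to_fract (qint_poly n) = qint (int n)"
  using qvar_neq_1
  by (simp add: qint_poly_def qint_def to_fract_monom sum_gp_strict)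

end

theory Submission
  imports Defs "HOL-Computational_Algebra.Fundamental_Theorem_Algebra"
begin

text \<open>The summand is Gosper-summable, since in the well-poised notation with base \<open>p = q\<^sup>2\<close> and
  \<open>a = b = c = d = 1 / q\<close> one has \<open>b c d = a / p\<close>. With \<open>\<beta> = (q; q\<^sup>2)\<^sub>N / (q\<^sup>2; q\<^sup>2)\<^sub>N\<close>, the sum up to
  \<open>N\<close> is \<open>- \<beta>\<^sup>4 (q (q + 1) (1 + q ^ (4 N + 1)) - 4 q ^ (2 N + 2)) / (q\<^sup>2 (1 - q)\<^sup>2)\<close>.
  For both values of \<open>N\<close>, integrality of the \<open>q\<close>-binomial coefficients gives \<open>\<beta> = [n] g / h\<close> with
  polynomials \<open>g\<close> and \<open>h\<close> such that \<open>h\<close> is coprime to \<open>[n]\<close>. This accounts for the factor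
  \<open>[n]\<^sup>4\<close>, and the remaining congruence modulo the cyclotomic polynomial is checked by evaluating \<open>g / h\<close>
  at the primitive \<open>n\<close>-th roots of unity.\<close>

section \<open>q-shifted factorials and the integrality of q-binomial coefficients\<close>

lemma qshift_0 [simp]: "qshift a r 0 = 1"
  by (simp add: qshift_def)

lemma qshift_Suc: "qshift a r (Suc k) = qshift a r k * (1 - a * r ^ k)"
  by (simp add: qshift_def)

lemma qshift_add: "qshift a r (k + l) = qshift a r k * qshift (a * r ^ k) r l"
  by (induction l) (simp_all add: qshift_Suc power_add mult_ac)

lemma qshift_eq_0_iff:
  fixes a :: "'a :: idom"
  shows "qshift a r k = 0 \<longleftrightarrow> (\<exists>i<k. a * r ^ i = 1)"
  by (auto simp: qshift_def)

lemma poly_qshift: "poly (qshift a r k) x = qshift (poly a x) (poly r x) k"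
  by (simp add: qshift_def poly_prod)

lemma to_fract_power: "to_fract (p ^ k) = to_fract p ^ k"
  by (induction k) (simp_all)

lemma to_fract_numeral: "to_fract (numeral m) = numeral m"
  by (metis of_nat_numeral of_nat_fract to_fract_def)

lemma to_fract_qshift: "to_fract (qshift a r k) = qshift (to_fract a) (to_fract r) k"
  by (induction k) (simp_all add: qshift_Suc to_fract_power)

text \<open>The quotient is a \<open>q\<close>-binomial coefficient; the induction is its Pascal recurrence.\<close>
lemma qshift_mult_dvd:
  fixes q :: "'a :: comm_ring_1"
  shows "qshift q q k * qshift q q l dvd qshift q q (k + l)"
proof (induction "k + l" arbitrary: k l rule: less_induct)
  case less
  show ?case
  proof (cases "k = 0 \<or> l = 0")
    case False
    then obtain k' l' where kl: "k = Suc k'" "l = Suc l'"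
      by (meson not0_implies_Suc)
    have "qshift q q k' * qshift q q l dvd qshift q q (k' + l)"
      and "qshift q q k * qshift q q l' dvd qshift q q (k + l')"
      using less[of k' l] less[of k l'] by (simp_all add: kl)
    then obtain g g' where g: "qshift q q (k' + l) = qshift q q k' * qshift q q l * g"
      and g': "qshift q q (k + l') = qshift q q k * qshift q q l' * g'"
      by (elim dvdE)
    let ?Q = "qshift q q (Suc (k' + l'))"
    have k: "qshift q q k = qshift q q k' * (1 - q ^ k)" and l: "qshift q q l = qshift q q l' * (1 - q ^ l)"
      by (simp_all add: kl qshift_Suc)
    \<comment> \<open>The last factor is split as
      \<open>1 - q ^ (k + l) = (1 - q ^ k) + q ^ k * (1 - q ^ l)\<close>.\<close>
    have "qshift q q (k + l) = ?Q * (1 - q ^ k) + ?Q * (1 - q ^ l) * q ^ k"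
      by (simp add: kl qshift_Suc[of _ _ "Suc (k' + l')"] algebra_simps power_add)
    also have "?Q * (1 - q ^ k) = qshift q q k * qshift q q l * g"
      using g by (simp add: k kl(2) mult_ac)
    also have "?Q * (1 - q ^ l) = qshift q q k * qshift q q l * g'"
      using g' by (simp add: l kl(1) mult_ac)
    also have "qshift q q k * qshift q q l * g + qshift q q k * qshift q q l * g' * q ^ k
        = qshift q q k * qshift q q l * (g + g' * q ^ k)"
      by (simp add: algebra_simps)
    finally show ?thesis by simp
  qed auto
qed

lemma power2_power:
  fixes x :: "'a :: monoid_mult"
  shows "x * (x ^ 2) ^ k = x ^ (2 * k + 1)" "x ^ 2 * (x ^ 2) ^ k = x ^ (2 * k + 2)"
  by (simp_all only: power_mult[symmetric] power_add[symmetric] power_Suc[symmetric]) simp_all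

text \<open>The exponents from 1 to \<open>2 * k\<close> are sorted into odd and even ones.\<close>

lemma qshift_even: "qshift q q (2 * k) = qshift q (q ^ 2) k * qshift (q ^ 2) (q ^ 2) k"
proof (induction k)
  case (Suc k)
  have "qshift q q (2 * Suc k) = qshift q q (2 * k) * ((1 - q * q ^ (2 * k)) * (1 - q ^ 2 * q ^ (2 * k)))"
    by (simp add: qshift_Suc power2_eq_square mult.assoc)
  also have "q ^ (2 * k) = (q ^ 2) ^ k"
    by (rule power_mult)
  finally show ?case
    by (simp only: Suc qshift_Suc) (simp only: mult_ac)
qed simp

lemma qshift_square: "qshift (q ^ 2) (q ^ 2) k = qshift q q k * qshift (- q) q k"
proof (induction k)
  case (Suc k)
  have "q ^ 2 * (q ^ 2) ^ k = (q * q ^ k) ^ 2"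
    by (metis power_Suc power_mult mult.commute)
  then have "1 - q ^ 2 * (q ^ 2) ^ k = (1 - q * q ^ k) * (1 - (- q) * q ^ k)"
    by (simp add: power2_eq_square algebra_simps)
  then show ?case
    by (simp add: Suc qshift_Suc mult_ac)
qed simp

section \<open>The closed form of the partial sums\<close>

text \<open>Here \<open>Y\<close> stands for \<open>q ^ (2 N + 2)\<close> and \<open>b\<close> for the quotient \<open>\<beta>\<close>.\<close>
lemma closed_form_step:
  fixes q Y :: "'a :: field"
  assumes "q \<noteq> 0" "q \<noteq> 1" "Y \<noteq> 1"
  shows "- ((b * (1 - Y / q) / (1 - Y)) ^ 4 * (q * (q + 1) * (1 + q * Y^2) - 4 * (q^2 * Y)) / (q^2 * (1 - q)^2))
    = - (b ^ 4 * (q * (q + 1) * (1 + Y^2 / q^3) - 4 * Y) / (q^2 * (1 - q)^2))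
      + (1 - Y^2 / q) / (1 - q) * ((1 - 1 / q) * b / (1 - Y)) ^ 4 * Y^2"
proof -
  have *: "1 - Y \<noteq> 0" "1 - q \<noteq> 0" using assms by auto
  have A: "1 - Y / q = (q - Y) / q" "1 - 1 / q = (q - 1) / q"
    "1 + Y^2 / q^3 = (q^3 + Y^2) / q^3" "1 - Y^2 / q = (q - Y^2) / q"
    using assms by (auto simp: field_simps)
  show ?thesis
    unfolding A using assms * by (simp add: divide_simps) algebra
qed

text \<open>Telescoping: by \<open>closed_form_step\<close>, the term at \<open>Suc N\<close> is the
  increment of the right-hand side. Since \<open>q\<close> is not a root of unity,
  \<open>1 - q\<close> and \<open>1 - Y\<close> are nonzero.\<close>

lemma sum_closed_form:
  fixes q :: "'a :: field"
  assumes "q \<noteq> 0" and nontorsion: "\<And>j. j > 0 \<Longrightarrow> q ^ j \<noteq> 1"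
  shows "(\<Sum>k=0..N. (1 - q powi (4 * int k - 1)) / (1 - q) *
      (qshift (inverse q) (q ^ 2) k ^ 4 / qshift (q ^ 2) (q ^ 2) k ^ 4) * q ^ (4 * k))
    = - ((qshift q (q ^ 2) N / qshift (q ^ 2) (q ^ 2) N) ^ 4 *
        (q * (q + 1) * (1 + q ^ (4 * N + 1)) - 4 * q ^ (2 * N + 2)) / (q ^ 2 * (1 - q) ^ 2))"
proof (induction N)
  case 0
  have "q \<noteq> 1" using nontorsion[of 1] by simp
  then have "1 - q \<noteq> 0" by simp
  \<comment> \<open>Both sides are \<open>- 1 / q\<close>, because
    \<open>q * (q + 1)^2 - 4 * q^2 = q * (1 - q)^2\<close>.\<close>
  have "(1 - inverse q) / (1 - q) = - ((q * (q + 1) * (1 + q) - 4 * q ^ 2) / (q ^ 2 * (1 - q) ^ 2))"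
    using \<open>q \<noteq> 0\<close> \<open>1 - q \<noteq> 0\<close> by (simp add: divide_simps) algebra
  then show ?case
    by (simp add: power_int_minus power2_eq_square)
next
  case (Suc N)
  define Y where "Y = q ^ (2 * N + 2)"
  have "q \<noteq> 1" "Y \<noteq> 1"
    using nontorsion[of 1] nontorsion[of "2 * N + 2"] by (simp_all add: Y_def)
  have "Y ^ 2 = q ^ ((2 * N + 2) * 2)"
    by (simp only: Y_def power_mult)
  also have "(2 * N + 2) * 2 = 4 * Suc N"
    by simp
  finally have Y2: "q ^ (4 * Suc N) = Y ^ 2" ..
  have "q powi (4 * int (Suc N) - 1) = q powi int (4 * Suc N) / q"
    using power_int_diff[of q "4 * int (Suc N)" 1] \<open>q \<noteq> 0\<close> by simp
  also have "\<dots> = Y ^ 2 / q"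
    unfolding power_int_of_nat Y2 ..
  finally have e1: "q powi (4 * int (Suc N) - 1) = Y ^ 2 / q" .
  have e2: "q ^ (4 * N + 1) = Y ^ 2 / q ^ 3"
    unfolding Y2[symmetric] using \<open>q \<noteq> 0\<close> by (simp add: field_simps power_add eval_nat_numeral)
  have e3: "q ^ (4 * Suc N + 1) = q * Y ^ 2"
    unfolding Y2[symmetric] by (simp only: Suc_eq_plus1[symmetric] power_Suc)
  have e4: "q ^ (2 * N + 2) = Y" "q ^ (2 * Suc N + 2) = q ^ 2 * Y"
    by (simp_all add: Y_def power2_eq_square)
  \<comment> \<open>Splitting off the first factor leaves the product starting at \<open>q\<close>,
    the one that occurs in the closed form.\<close>
  have e5: "qshift (inverse q) (q ^ 2) (Suc N) = (1 - 1 / q) * qshift q (q ^ 2) N"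
    using qshift_add[of "inverse q" "q ^ 2" 1 N] \<open>q \<noteq> 0\<close>
    by (simp add: qshift_Suc field_simps power2_eq_square)
  have e6: "qshift q (q ^ 2) (Suc N) = qshift q (q ^ 2) N * (1 - Y / q)"
    using \<open>q \<noteq> 0\<close> by (simp add: qshift_Suc Y_def power_mult power2_eq_square power_add)
  have e7: "qshift (q ^ 2) (q ^ 2) (Suc N) = qshift (q ^ 2) (q ^ 2) N * (1 - Y)"
    by (simp add: qshift_Suc Y_def power_mult power2_eq_square power_add)
  let ?a = "qshift q (q ^ 2) N" and ?b = "qshift (q ^ 2) (q ^ 2) N"
  have e8: "((1 - 1 / q) * ?a) ^ 4 / (?b * (1 - Y)) ^ 4 = ((1 - 1 / q) * (?a / ?b) / (1 - Y)) ^ 4"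
    by (simp add: power_divide power_mult_distrib)
  have e9: "?a * (1 - Y / q) / (?b * (1 - Y)) = ?a / ?b * (1 - Y / q) / (1 - Y)"
    by simp
  show ?case
    unfolding sum.atLeast0_atMost_Suc Suc.IH e1 e2 e3 e4 e5 e6 e7 e8 e9 Y2
    by (rule closed_form_step[symmetric]) fact+
qed

section \<open>Complex polynomials: coprimality and cyclotomic divisibility via roots\<close>

text \<open>The indeterminate as a polynomial, so that it can be evaluated at roots of unity;
  \<open>to_fract\<close> carries it to \<open>qvar\<close>.\<close>

definition X :: "complex poly" where
  "X = [:0, 1:]"

lemma poly_X [simp]: "poly X x = x"
  by (simp add: X_def)

lemma to_fract_X: "to_fract X = qvar"
  by (simp add: X_def qvar_def)

lemma qshift_poly_nonzero:
  fixes a :: "'a :: idom poly"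
  assumes "poly a 0 = 0"
  shows "qshift a r k \<noteq> 0"
proof -
  have "poly (qshift a r k) 0 = 1"
    by (simp add: assms qshift_def poly_prod)
  then show ?thesis by auto
qed

lemma qint_poly_eq: "qint_poly n = (\<Sum>i<n. X ^ i)"
  by (simp add: qint_poly_def X_def monom_altdef)

text \<open>This recurrence makes consecutive q-integers coprime: a common divisor divides
  1.\<close>

lemma qint_poly_Suc: "qint_poly (Suc n) = 1 + X * qint_poly n"
  by (simp add: qint_poly_eq sum.lessThan_Suc_shift sum_distrib_left del: sum.lessThan_Suc)

lemma one_minus_X_mult_qint_poly: "(1 - X) * qint_poly n = 1 - X ^ n"
  by (simp add: qint_poly_eq one_diff_power_eq)

lemma poly_qint_poly: "poly (qint_poly n) x = (\<Sum>i<n. x ^ i)"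
  by (simp add: qint_poly_eq poly_sum)

lemma root_qint_polyD:
  assumes "poly (qint_poly n) x = 0"
  shows "x ^ n = 1"
  using assms one_diff_power_eq[of x n] by (simp add: poly_qint_poly)

text \<open>By the fundamental theorem of algebra, a nonconstant common divisor would yield a common
  root.\<close>

lemma coprime_complex_polyI:
  fixes p r :: "complex poly"
  assumes "p \<noteq> 0" "\<And>x. poly p x = 0 \<Longrightarrow> poly r x \<noteq> 0"
  shows "coprime p r"
proof (rule coprimeI)
  fix c assume c: "c dvd p" "c dvd r"
  have "\<not> (\<exists>x. poly c x = 0)"
    using c assms(2) by (metis dvdE mult_eq_0_iff poly_mult)
  then have "degree c = 0"
    by (metis constant_degree fundamental_theorem_of_algebra)
  then show "is_unit c"
    using c(1) \<open>p \<noteq> 0\<close> by (metis dvd_0_left_iff is_unit_iff_degree)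
qed

text \<open>Linear factors are split off one by one; as the roots are distinct, the cofactor still
  vanishes at the remaining ones.\<close>

lemma prod_linear_dvd:
  fixes p :: "'b :: field poly"
  assumes "finite A" "inj_on f A" "\<And>a. a \<in> A \<Longrightarrow> poly p (f a) = 0"
  shows "(\<Prod>a\<in>A. [:- f a, 1:]) dvd p"
  using assms
proof (induction A arbitrary: p rule: finite_induct)
  case (insert a A)
  then obtain r where r: "p = [:- f a, 1:] * r"
    by (metis dvdE insertI1 poly_eq_0_iff_dvd)
  have "poly r (f b) = 0" if "b \<in> A" for b
  proof -
    have "f b \<noteq> f a" using insert that by (auto simp: inj_on_def)
    then show ?thesis using insert.prems(2)[of b] that by (auto simp: r)
  qed
  then have "(\<Prod>a\<in>A. [:- f a, 1:]) dvd r"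
    using insert by auto
  then have "[:- f a, 1:] * (\<Prod>a\<in>A. [:- f a, 1:]) dvd p"
    unfolding r by (rule mult_dvd_mono[OF dvd_refl])
  then show ?case
    using insert.hyps by simp
qed simp

text \<open>The roots of \<open>cyclotomic n\<close> are simple and are primitive n-th roots of
  unity. Primitivity of \<open>z\<close> is expressed by \<open>n dvd j\<close> whenever
  \<open>z ^ j = 1\<close>.\<close>

lemma cyclotomic_dvd:
  assumes "n > 1" "\<And>z. z ^ n = 1 \<Longrightarrow> (\<And>j. z ^ j = 1 \<Longrightarrow> n dvd j) \<Longrightarrow> poly p z = 0"
  shows "cyclotomic n dvd p"
  unfolding cyclotomic_def
proof (rule prod_linear_dvd)
  let ?z = "\<lambda>k. cis (2 * pi * real k / real n)"
  let ?A = "{k. 1 \<le> k \<and> k \<le> n \<and> coprime k n}"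
  have bij: "bij_betw ?z {..<n} {z. z ^ n = 1}"
    using bij_betw_roots_unity[of n] \<open>n > 1\<close> by simp
  have less: "k < n" if "k \<in> ?A" for k
    using that \<open>n > 1\<close> by (cases "k = n") auto
  show "finite ?A" by (rule finite_subset[of _ "{..n}"]) auto
  show "inj_on ?z ?A"
    using bij less by (auto simp: bij_betw_def intro: inj_on_subset)
  fix k assume k: "k \<in> ?A"
  show "poly p (?z k) = 0"
  proof (rule assms(2))
    show "?z k ^ n = 1"
      using bij less[OF k] by (auto simp: bij_betw_def)
    fix j assume j: "?z k ^ j = 1"
    \<comment> \<open>Reduction modulo \<open>n\<close> brings the index into \<open>{..<n}\<close>,
      where \<open>?z\<close> is injective.\<close>
    have "?z k ^ j = ?z ((k * j) mod n)"
    proof -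
      have "?z k ^ j = cis (2 * pi * real (k * j) / real n)"
        by (simp add: DeMoivre mult_ac)
      also have "real (k * j) = real (k * j mod n) + real n * real (k * j div n)"
        by (metis mod_mult_div_eq of_nat_add of_nat_mult)
      also have "cis (2 * pi * \<dots> / real n) = ?z (k * j mod n) * cis (2 * pi * real (k * j div n))"
        using \<open>n > 1\<close> by (simp add: cis_mult field_simps)
      also have "cis (2 * pi * real (k * j div n)) = 1"
        by (rule cis_multiple_2pi) simp
      finally show ?thesis by simp
    qed
    then have "?z (k * j mod n) = ?z 0" using j by simp
    moreover have "k * j mod n \<in> {..<n}" "0 \<in> {..<n}" using \<open>n > 1\<close> by auto
    ultimately have "k * j mod n = 0"
      using bij unfolding bij_betw_def inj_on_def by blast
    then show "n dvd j"
      using k by (auto simp: coprime_commute coprime_dvd_mult_right_iff simp flip: dvd_eq_mod_eq_0)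
  qed
qed

section \<open>Reduction of the congruence to primitive roots of unity\<close>

text \<open>\<open>ratio\<close> expresses the quotient in the closed form as
  \<open>[n] g / h\<close>. \<open>root\<close> is the claim divided by \<open>[n]^4\<close>, with
  denominators cleared, at a primitive root \<open>z\<close>.\<close>

lemma ratfun_cong_criterion:
  assumes "n > 1"
    and ratio: "qshift X (X ^ 2) N * h = qint_poly n * g * qshift (X ^ 2) (X ^ 2) N"
    and h: "\<And>x. x ^ n = 1 \<Longrightarrow> poly h x \<noteq> 0"
    and root: "\<And>z. z ^ n = 1 \<Longrightarrow> (\<And>j. z ^ j = 1 \<Longrightarrow> n dvd j) \<Longrightarrow>
      poly g z ^ 4 * (z * (z + 1) * (1 + z ^ (4 * N + 1)) - 4 * z ^ (2 * N + 2)) =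
      (1 + 3 * z + z ^ 2) * (z ^ 2 * poly h z ^ 4 * (1 - z) ^ 2)"
  shows "ratfun_cong
           (\<Sum>k=0..N. qint (4 * int k - 1) *
              (qshift (inverse qvar) (qvar ^ 2) k ^ 4 / qshift (qvar ^ 2) (qvar ^ 2) k ^ 4) *
              qvar ^ (4 * k))
           (- (1 + 3 * qvar + qvar ^ 2) * qint (int n) ^ 4)
           (qint_poly n ^ 4 * cyclotomic n)"
proof -
  \<comment> \<open>\<open>B\<close> is the bracket of the closed form; the difference of the two
    sides will be \<open>[n]^4 * w / v\<close>.\<close>
  define B where "B = X * (X + 1) * (1 + X ^ (4 * N + 1)) - 4 * X ^ (2 * N + 2)"
  define v where "v = X ^ 2 * h ^ 4 * (1 - X) ^ 2"
  define w where "w = (1 + 3 * X + X ^ 2) * v - g ^ 4 * B"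
  have "h \<noteq> 0" using h[of 1] by auto
  have X: "X ^ j \<noteq> 1" if "j > 0" for j
  proof
    assume "X ^ j = 1"
    then have "poly (X ^ j) 0 = 1" by simp
    with that show False by (simp add: power_0_left)
  qed
  have "X \<noteq> 0" by (simp add: X_def)
  have "v \<noteq> 0" using \<open>h \<noteq> 0\<close> \<open>X \<noteq> 0\<close> X[of 1] by (simp add: v_def)
  \<comment> \<open>Besides the roots of \<open>h\<close>, \<open>v\<close> has only the roots 0 and
    1, and neither is a root of \<open>[n]\<close>.\<close>
  have qint_0: "poly (qint_poly n) 0 \<noteq> 0"
    using root_qint_polyD[of n 0] \<open>n > 1\<close> by (auto simp: power_0_left)
  have qint_1: "poly (qint_poly n) 1 \<noteq> 0"
    using \<open>n > 1\<close> by (simp add: poly_qint_poly)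
  have coprime: "coprime v (qint_poly n)"
  proof (rule coprime_complex_polyI[OF \<open>v \<noteq> 0\<close>])
    fix x assume "poly v x = 0"
    then have "x = 0 \<or> x = 1 \<or> poly h x = 0" by (auto simp: v_def)
    then show "poly (qint_poly n) x \<noteq> 0"
      using qint_0 qint_1 h root_qint_polyD by blast
  qed
  \<comment> \<open>Hence coprimality to \<open>[n]\<close> gives coprimality to the whole
    modulus.\<close>
  have "cyclotomic n dvd qint_poly n"
  proof (rule cyclotomic_dvd[OF \<open>n > 1\<close>])
    fix z :: complex assume "z ^ n = 1" "\<And>j. z ^ j = 1 \<Longrightarrow> n dvd j"
    then have "z \<noteq> 1" using \<open>n > 1\<close> by (metis nat_dvd_1_iff_1 less_irrefl power_one)
    then show "poly (qint_poly n) z = 0"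
      using \<open>z ^ n = 1\<close> one_diff_power_eq[of z n] by (simp add: poly_qint_poly)
  qed
  then have "coprime v (cyclotomic n)"
    by (rule coprime_divisors[OF dvd_refl _ coprime])
  then have coprime': "coprime v (qint_poly n ^ 4 * cyclotomic n)"
    using coprime by simp
  have "cyclotomic n dvd w"
  proof (rule cyclotomic_dvd[OF \<open>n > 1\<close>])
    fix z :: complex assume z: "z ^ n = 1" "\<And>j. z ^ j = 1 \<Longrightarrow> n dvd j"
    show "poly w z = 0"
      using root[OF z] by (simp add: w_def v_def B_def)
  qed
  then have dvd: "qint_poly n ^ 4 * cyclotomic n dvd qint_poly n ^ 4 * w"
    by simp
  have "qshift (X ^ 2) (X ^ 2) N \<noteq> 0" by (rule qshift_poly_nonzero) simp
  have nz: "to_fract h \<noteq> 0" "to_fract (qshift (X ^ 2) (X ^ 2) N) \<noteq> 0" "qvar \<noteq> 0" "1 - qvar \<noteq> 0"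
    using \<open>h \<noteq> 0\<close> \<open>qshift (X ^ 2) (X ^ 2) N \<noteq> 0\<close> \<open>X \<noteq> 0\<close> qvar_neq_1
    by (simp_all flip: to_fract_X)
  have ratio': "qshift qvar (qvar ^ 2) N / qshift (qvar ^ 2) (qvar ^ 2) N =
      to_fract (qint_poly n) * (to_fract g / to_fract h)"
    using arg_cong[OF ratio, of to_fract] nz
    by (simp add: to_fract_qshift to_fract_power to_fract_X field_simps)
  have B: "to_fract B = qvar * (qvar + 1) * (1 + qvar ^ (4 * N + 1)) - 4 * qvar ^ (2 * N + 2)"
    by (simp add: B_def to_fract_power to_fract_X to_fract_numeral)
  have v: "to_fract v = qvar ^ 2 * to_fract h ^ 4 * (1 - qvar) ^ 2"
    by (simp add: v_def to_fract_power to_fract_X)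
  have w: "to_fract w = (1 + 3 * qvar + qvar ^ 2) * to_fract v - to_fract g ^ 4 * to_fract B"
    by (simp add: w_def to_fract_power to_fract_X to_fract_numeral)
  have "qvar ^ j \<noteq> 1" if "j > 0" for j
    using X[OF that] by (metis to_fract_1 to_fract_X to_fract_eq_iff to_fract_power)
  from sum_closed_form[OF nz(3) this, of N]
  have sum: "(\<Sum>k=0..N. qint (4 * int k - 1) *
      (qshift (inverse qvar) (qvar ^ 2) k ^ 4 / qshift (qvar ^ 2) (qvar ^ 2) k ^ 4) * qvar ^ (4 * k))
    = - ((to_fract (qint_poly n) * (to_fract g / to_fract h)) ^ 4 * to_fract B /
      (qvar ^ 2 * (1 - qvar) ^ 2))"
    unfolding qint_def B ratio' .
  have eq: "- ((to_fract (qint_poly n) * (to_fract g / to_fract h)) ^ 4 * to_fract B /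
      (qvar ^ 2 * (1 - qvar) ^ 2)) - - (1 + 3 * qvar + qvar ^ 2) * to_fract (qint_poly n) ^ 4
     = to_fract (qint_poly n) ^ 4 * to_fract w / to_fract v"
    using nz unfolding w v by (simp add: field_simps)
  show ?thesis
    unfolding ratfun_cong_def
  proof (intro exI conjI)
    show "(\<Sum>k=0..N. qint (4 * int k - 1) *
        (qshift (inverse qvar) (qvar ^ 2) k ^ 4 / qshift (qvar ^ 2) (qvar ^ 2) k ^ 4) * qvar ^ (4 * k))
      - - (1 + 3 * qvar + qvar ^ 2) * qint (int n) ^ 4 = Fract (qint_poly n ^ 4 * w) v"
      unfolding sum to_fract_qint_poly[symmetric] eq
      by (simp add: Fract_conv_to_fract to_fract_power)
  qed fact+
qed

section \<open>Central q-binomials and products at roots of unity\<close>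

text \<open>Here \<open>g\<close> is the central q-binomial coefficient. Sorting exponents by parity
  and factoring \<open>1 - q ^ (2 * i)\<close> as a difference of squares leaves a common factor
  \<open>qshift X X k\<close> to cancel.\<close>

lemma qshift_middle:
  assumes "qshift X X (2 * k) = qshift X X k ^ 2 * g"
  shows "qshift X (X ^ 2) k * qshift (- X) X k ^ 2 = g * qshift (X ^ 2) (X ^ 2) k"
proof -
  have "qshift X X k \<noteq> 0" by (rule qshift_poly_nonzero) simp
  have "qshift X (X ^ 2) k * (qshift X X k * qshift (- X) X k) = qshift X X k ^ 2 * g"
    using assms by (simp only: qshift_even qshift_square)
  then show ?thesis
    using \<open>qshift X X k \<noteq> 0\<close> unfolding qshift_square by algebra
qed

text \<open>A zero factor would make a power of \<open>x\<close> equal to -1; its n-th power would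
  be both -1 and 1. This keeps the denominators \<open>h\<close> nonzero.\<close>

lemma qshift_minus_root_nonzero:
  fixes x :: complex
  assumes "x ^ n = 1" "odd n"
  shows "qshift (- x) x k \<noteq> 0"
proof -
  have "x * x ^ i \<noteq> - 1" for i
  proof
    assume "x * x ^ i = - 1"
    then have "(- 1) ^ n = (x ^ n) ^ Suc i"
      by (metis power_Suc power_mult mult.commute)
    then show False using assms by simp
  qed
  then show ?thesis
    by (auto simp: qshift_eq_0_iff minus_equation_iff[of "x * _"]) (metis add.inverse_inverse)
qed

text \<open>The exponents on the two sides correspond under \<open>e \<mapsto> n - e\<close>, where \<open>n = 2 M + 1\<close>.\<close>
lemma qshift_odd_at_root:
  fixes z :: "'a :: field"
  assumes "z ^ (2 * M + 1) = 1"
  shows "qshift z (z ^ 2) M * z ^ (M * (M + 1)) = (- 1) ^ M * qshift (z ^ 2) (z ^ 2) M"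
proof -
  \<comment> \<open>This power collects the multipliers \<open>z ^ e\<close>, for
    \<open>e = 2, 4, ..., 2 * M\<close>, that turn each \<open>1 - z ^ (n - e)\<close> into
    \<open>z ^ e - 1\<close>.\<close>
  have exponent: "(\<Prod>i<M. z ^ (2 * i + 2)) = z ^ (M * (M + 1))"
  proof (induction M)
    case (Suc M)
    have "M * (M + 1) + (2 * M + 2) = Suc M * (Suc M + 1)" by simp
    then show ?case
      by (simp only: prod.lessThan_Suc Suc power_add[symmetric])
  qed simp
  have "qshift z (z ^ 2) M = (\<Prod>i<M. 1 - z * (z ^ 2) ^ (M - Suc i))"
    unfolding qshift_def by (rule prod.nat_diff_reindex[symmetric])
  then have "qshift z (z ^ 2) M * z ^ (M * (M + 1)) =
      (\<Prod>i<M. (1 - z * (z ^ 2) ^ (M - Suc i)) * z ^ (2 * i + 2))"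
    by (simp only: exponent[symmetric] prod.distrib)
  also have "\<dots> = (\<Prod>i<M. (- 1) * (1 - z ^ 2 * (z ^ 2) ^ i))"
  proof (rule prod.cong[OF refl])
    fix i assume "i \<in> {..<M}"
    then have "2 * (M - Suc i) + 1 + (2 * i + 2) = 2 * M + 1"
      by auto
    then have "z * (z ^ 2) ^ (M - Suc i) * z ^ (2 * i + 2) = 1"
      using assms unfolding power2_power power_add[symmetric] by simp
    then show "(1 - z * (z ^ 2) ^ (M - Suc i)) * z ^ (2 * i + 2) = (- 1) * (1 - z ^ 2 * (z ^ 2) ^ i)"
      unfolding power2_power left_diff_distrib by simp
  qed
  also have "\<dots> = (- 1) ^ M * qshift (z ^ 2) (z ^ 2) M"
    by (simp only: prod.distrib qshift_def prod_constant card_lessThan)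
  finally show ?thesis .
qed

text \<open>As \<open>n\<close> is odd, a vanishing factor would force \<open>n\<close> to divide
  some \<open>Suc i \<le> k < n\<close>.\<close>

lemma primitive_root_qshift_nonzero:
  fixes z :: "'a :: field"
  assumes "odd n" "\<And>j. z ^ j = 1 \<Longrightarrow> n dvd j" "k < n"
  shows "qshift (z ^ 2) (z ^ 2) k \<noteq> 0"
proof -
  have False if "i < k" "z ^ 2 * (z ^ 2) ^ i = 1" for i
  proof -
    have "z ^ (2 * Suc i) = 1" using that(2) by (simp only: power_mult power_Suc)
    then have "n dvd 2 * Suc i" by (rule assms(2))
    then have "n dvd Suc i"
      using \<open>odd n\<close> by (metis coprime_dvd_mult_right_iff coprime_right_2_iff_odd)
    then show False using that(1) \<open>k < n\<close> by (auto dest: dvd_imp_le)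
  qed
  then show ?thesis by (auto simp: qshift_eq_0_iff)
qed

section \<open>The sum up to \<open>(n + 1) / 2\<close>\<close>

text \<open>The last factor of the quotient is
  \<open>(1 - q ^ n) / (1 - q ^ (n + 1)) = [n] / [n + 1]\<close>, which supplies \<open>[n]\<close>;
  the first \<open>M\<close> factors give a central q-binomial over \<open>h0\<close>.\<close>

lemma middle_sum_cong:
  assumes "n = 2 * M + 1" "M > 0"
  shows "ratfun_cong
           (\<Sum>k=0..M + 1. qint (4 * int k - 1) *
              (qshift (inverse qvar) (qvar ^ 2) k ^ 4 / qshift (qvar ^ 2) (qvar ^ 2) k ^ 4) *
              qvar ^ (4 * k))
           (- (1 + 3 * qvar + qvar ^ 2) * qint (int n) ^ 4)
           (qint_poly n ^ 4 * cyclotomic n)"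
proof -
  have "qshift X X M ^ 2 dvd qshift X X (2 * M)"
    using qshift_mult_dvd[of X M M] by (simp only: mult_2 power2_eq_square)
  then obtain g where "qshift X X (2 * M) = qshift X X M ^ 2 * g" ..
  note g = qshift_middle[OF this]
  define h0 where "h0 = qshift (- X) X M ^ 2"
  have "odd n" "n > 1" using assms by auto
  have X_M: "X * (X ^ 2) ^ M = X ^ n" "X ^ 2 * (X ^ 2) ^ M = X ^ Suc n"
    using power2_power[of X M] by (simp_all add: assms(1))
  show ?thesis
  proof (rule ratfun_cong_criterion[OF \<open>n > 1\<close>, of "M + 1" "h0 * qint_poly (Suc n)" g])
    show "qshift X (X ^ 2) (M + 1) * (h0 * qint_poly (Suc n)) =
        qint_poly n * g * qshift (X ^ 2) (X ^ 2) (M + 1)"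
      using g unfolding Suc_eq_plus1[of M, symmetric] qshift_Suc X_M h0_def
        one_minus_X_mult_qint_poly[symmetric] by algebra
  next
    fix x :: complex assume x: "x ^ n = 1"
    \<comment> \<open>At an n-th root of unity, \<open>[n + 1]\<close> is 1, except at
      \<open>x = 1\<close>, where it is \<open>n + 1\<close>.\<close>
    have "(1 - x) * poly (qint_poly (Suc n)) x = 1 - x"
      using x arg_cong[OF one_minus_X_mult_qint_poly, of "\<lambda>p. poly p x" "Suc n"] by simp
    then have "poly (qint_poly (Suc n)) x \<noteq> 0"
      by (cases "x = 1") (auto simp: poly_qint_poly simp del: sum.lessThan_Suc of_nat_Suc)
    then show "poly (h0 * qint_poly (Suc n)) x \<noteq> 0"
      using qshift_minus_root_nonzero[OF x \<open>odd n\<close>] by (simp add: h0_def poly_qshift)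
  next
    fix z :: complex assume z: "z ^ n = 1" "\<And>j. z ^ j = 1 \<Longrightarrow> n dvd j"
    have "z \<noteq> 1" using z(2)[of 1] \<open>n > 1\<close> by auto
    have "(1 - z) * poly (qint_poly (Suc n)) z = 1 - z"
      using z(1) arg_cong[OF one_minus_X_mult_qint_poly, of "\<lambda>p. poly p z" "Suc n"] by simp
    then have 1: "poly (qint_poly (Suc n)) z = 1" using \<open>z \<noteq> 1\<close> by simp
    let ?E = "qshift (z ^ 2) (z ^ 2) M"
    have "?E \<noteq> 0"
      by (rule primitive_root_qshift_nonzero[OF \<open>odd n\<close>], erule z(2)) (simp add: assms)
    have "qshift z (z ^ 2) M * poly h0 z = poly g z * ?E"
      using arg_cong[OF g, of "\<lambda>p. poly p z"] by (simp add: poly_qshift h0_def)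
    \<comment> \<open>Fourth powers remove the sign \<open>s\<close>, and
      \<open>z * w ^ 4 = 1\<close> because \<open>4 * M * (M + 1) + 1 = n^2\<close>.\<close>
    moreover define w s where "w = z ^ (M * (M + 1))" and "s = (- 1 :: complex) ^ M"
    have "qshift z (z ^ 2) M * w = s * ?E"
      unfolding w_def s_def using qshift_odd_at_root z(1) assms(1) by blast
    ultimately have "poly g z * w = s * poly h0 z"
      using \<open>?E \<noteq> 0\<close> by algebra
    moreover have "s ^ 2 = 1"
      by (simp add: w_def s_def flip: power_mult)
    moreover have "z * w ^ 4 = 1"
    proof -
      have "z * w ^ 4 = z ^ (n * n)"
        unfolding w_def s_def power_mult[symmetric] power_Suc[symmetric]
        by (rule arg_cong[of _ _ "power z"]) (simp add: assms(1) algebra_simps)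
      then show ?thesis by (simp add: power_mult z(1))
    qed
    ultimately have g4: "poly g z ^ 4 = z * poly h0 z ^ 4"
      by algebra
    have "4 * (M + 1) + 1 = n * 2 + 3" "2 * (M + 1) + 2 = n + 3"
      using assms(1) by simp_all
    then have exps: "z ^ (4 * (M + 1) + 1) = z ^ 3" "z ^ (2 * (M + 1) + 2) = z ^ 3"
      by (simp_all only: power_add power_mult z(1) power_one mult_1)
    \<comment> \<open>The factor in the theorem comes from \<open>(z + 1) * (1 + z^3) - 4 * z^2 = (1
      - z)^2 * (1 + 3 * z + z^2)\<close>.\<close>
    show "poly g z ^ 4 * (z * (z + 1) * (1 + z ^ (4 * (M + 1) + 1)) - 4 * z ^ (2 * (M + 1) + 2)) =
        (1 + 3 * z + z ^ 2) * (z ^ 2 * poly (h0 * qint_poly (Suc n)) z ^ 4 * (1 - z) ^ 2)"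
      unfolding g4 exps poly_mult 1 by algebra
  qed
qed

section \<open>The sum up to \<open>n - 1\<close>\<close>

text \<open>Here \<open>[n]\<close> divides the central q-binomial \<open>g0\<close> itself. The
  value of \<open>g / h\<close> at a primitive root is found by cancelling \<open>[n]\<close> before
  evaluating.\<close>

lemma full_sum_cong:
  assumes "n = 2 * M + 1" "M > 0"
  shows "ratfun_cong
           (\<Sum>k=0..2 * M. qint (4 * int k - 1) *
              (qshift (inverse qvar) (qvar ^ 2) k ^ 4 / qshift (qvar ^ 2) (qvar ^ 2) k ^ 4) *
              qvar ^ (4 * k))
           (- (1 + 3 * qvar + qvar ^ 2) * qint (int n) ^ 4)
           (qint_poly n ^ 4 * cyclotomic n)"
proof -
  have "odd n" "n > 1" using assms by auto
  obtain M' where M': "M = Suc M'" using \<open>M > 0\<close> by (cases M) auto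
  let ?N = "2 * M"
  have n: "n = Suc ?N" using assms by simp
  have "qshift X X ?N ^ 2 dvd qshift X X (2 * ?N)"
    using qshift_mult_dvd[of X ?N ?N] by (simp only: mult_2 power2_eq_square)
  then obtain g0 where g0: "qshift X X (2 * ?N) = qshift X X ?N ^ 2 * g0" ..
  \<comment> \<open>\<open>g1\<close> is the neighbouring q-binomial, with lower index
    \<open>n\<close> or equivalently \<open>n - 2\<close>.\<close>
  obtain g1 where "qshift X X (Suc ?N + (2 * M' + 1)) = qshift X X (Suc ?N) * qshift X X (2 * M' + 1) * g1"
    using qshift_mult_dvd by blast
  moreover have "Suc ?N + (2 * M' + 1) = 2 * ?N" "?N = Suc (2 * M' + 1)"
    by (simp_all add: M')
  ultimately have g1: "qshift X X (2 * ?N) = qshift X X (Suc ?N) * qshift X X (2 * M' + 1) * g1"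
      and N: "qshift X X ?N = qshift X X (2 * M' + 1) * (1 - X ^ ?N)"
    by (simp_all only: qshift_Suc power_Suc)
  have nz: "qshift X X ?N \<noteq> 0" "qshift X X (2 * M' + 1) \<noteq> 0" "1 - X \<noteq> 0"
    using qshift_poly_nonzero[of X X ?N] qshift_poly_nonzero[of X X "2 * M' + 1"]
      qshift_poly_nonzero[of X X 1] by (simp_all add: qshift_Suc)
  have "qshift X X ?N * (1 - X ^ n) * qshift X X (2 * M' + 1) * g1 = qshift X X ?N ^ 2 * g0"
    using g0 g1 by (simp add: n qshift_Suc)
  also have "\<dots> = qshift X X ?N * (qshift X X (2 * M' + 1) * (1 - X ^ ?N)) * g0"
    unfolding N[symmetric] power2_eq_square ..
  finally have "(qshift X X ?N * qshift X X (2 * M' + 1)) * ((1 - X ^ n) * g1) =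
      (qshift X X ?N * qshift X X (2 * M' + 1)) * (g0 * (1 - X ^ ?N))"
    by (simp only: mult_ac)
  then have "(1 - X ^ n) * g1 = g0 * (1 - X ^ ?N)"
    using nz(1,2) by simp
  then have "qint_poly n * g1 = g0 * qint_poly ?N"
    using nz(3) unfolding one_minus_X_mult_qint_poly[symmetric] by (simp add: mult_ac)
  then have "qint_poly n dvd g0 * qint_poly ?N"
    by (metis dvd_triv_left)
  \<comment> \<open>As for the Catalan numbers, \<open>g0 / [n]\<close> is a polynomial because \<open>g0 [n - 1] / [n]\<close> is one.\<close>
  moreover have "coprime (qint_poly n) (qint_poly ?N)"
    by (rule coprimeI) (metis n qint_poly_Suc dvd_add_left_iff dvd_mult)
  ultimately have "qint_poly n dvd g0"
    by (simp add: coprime_dvd_mult_left_iff)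
  then obtain g where g: "g0 = qint_poly n * g" ..
  define h where "h = qshift (- X) X ?N ^ 2"
  have ratio: "qshift X (X ^ 2) ?N * h = qint_poly n * g * qshift (X ^ 2) (X ^ 2) ?N"
    using qshift_middle[OF g0] by (simp only: g h_def)
  show ?thesis
  proof (rule ratfun_cong_criterion[OF \<open>n > 1\<close> ratio])
    fix x :: complex assume x: "x ^ n = 1"
    then show "poly h x \<noteq> 0"
      using qshift_minus_root_nonzero[OF x \<open>odd n\<close>] by (simp add: h_def poly_qshift)
  next
    fix z :: complex assume z: "z ^ n = 1" "\<And>j. z ^ j = 1 \<Longrightarrow> n dvd j"
    let ?O = "qshift z (z ^ 2) M" and ?E = "qshift (z ^ 2) (z ^ 2)"
    have "?E k \<noteq> 0" if "k < n" for k
      by (rule primitive_root_qshift_nonzero[OF \<open>odd n\<close>], erule z(2), rule that)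
    then have nonzero: "?E M \<noteq> 0" "?E M' \<noteq> 0"
      by (simp_all add: n M')
    have "?O * z ^ (M * (M + 1)) = (- 1) ^ M * ?E M"
      using qshift_odd_at_root z(1) assms(1) by blast
    then have "?O \<noteq> 0" using nonzero(1) by auto
    \<comment> \<open>Both products are cut after \<open>M\<close> factors. The second half of the
      numerator starts with \<open>1 - X ^ n\<close>, the factor that cancels against
      \<open>[n]\<close>.\<close>
    have X_M: "X * (X ^ 2) ^ M = X ^ n" "X ^ 2 * (X ^ 2) ^ M = X ^ Suc n"
      using power2_power[of X M] by (simp_all add: n)
    have "qshift (X ^ n) (X ^ 2) M = (1 - X ^ n) * qshift (X ^ n * X ^ 2) (X ^ 2) M'"
      using qshift_add[of "X ^ n" "X ^ 2" 1 M'] by (simp add: M' qshift_Suc[of _ _ 0])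
    then have num: "qshift X (X ^ 2) ?N = qshift X (X ^ 2) M * ((1 - X ^ n) * qshift (X ^ n * X ^ 2) (X ^ 2) M')"
      by (simp only: mult_2 qshift_add X_M)
    have den: "qshift (X ^ 2) (X ^ 2) ?N = qshift (X ^ 2) (X ^ 2) M * qshift (X ^ Suc n) (X ^ 2) M"
      by (simp only: mult_2 qshift_add X_M)
    have "qint_poly n \<noteq> 0"
      using one_minus_X_mult_qint_poly[of n] qshift_poly_nonzero[of "X ^ n" X 1] \<open>n > 1\<close>
      by (auto simp: qshift_Suc power_0_left)
    moreover have "qint_poly n * (qshift X (X ^ 2) M * (1 - X) * qshift (X ^ n * X ^ 2) (X ^ 2) M' * h) =
        qint_poly n * (g * (qshift (X ^ 2) (X ^ 2) M * qshift (X ^ Suc n) (X ^ 2) M))"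
      using ratio unfolding num den one_minus_X_mult_qint_poly[symmetric] by (simp only: mult_ac)
    ultimately have "qshift X (X ^ 2) M * (1 - X) * qshift (X ^ n * X ^ 2) (X ^ 2) M' * h =
        g * (qshift (X ^ 2) (X ^ 2) M * qshift (X ^ Suc n) (X ^ 2) M)"
      by simp
    \<comment> \<open>Since \<open>z ^ n = 1\<close>, the second halves wrap around to
      \<open>?E M'\<close> and \<open>?O\<close>.\<close>
    from arg_cong[OF this, of "\<lambda>p. poly p z"]
    have "?O * (1 - z) * ?E M' * poly h z = poly g z * (?E M * ?O)"
      using z(1) by (simp add: poly_qshift)
    \<comment> \<open>\<open>y\<close> is the inverse of \<open>z\<close>, so what remains is
      \<open>(1 - z) h = g (1 - 1 / z)\<close>, that is, \<open>g = - z h\<close>.\<close>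
    moreover define y where "y = z ^ ?N"
    have "?E M = ?E M' * (1 - y)"
      by (simp add: y_def M' qshift_Suc power_mult power2_eq_square)
    ultimately have "(1 - z) * poly h z = poly g z * (1 - y)"
      using \<open>?O \<noteq> 0\<close> nonzero(2) by algebra
    moreover have "z * y = 1"
      using z(1) by (simp add: y_def n)
    ultimately have "(1 - z) * (poly g z + z * poly h z) = 0"
      by algebra
    moreover have "z \<noteq> 1" using z(2)[of 1] \<open>n > 1\<close> by auto
    ultimately have g4: "poly g z ^ 4 = z ^ 4 * poly h z ^ 4"
      by algebra
    \<comment> \<open>\<open>w\<close> is the inverse of \<open>z^3\<close>; multiplying the bracket
      by \<open>z^2\<close> leads to the same factorization as for the shorter sum.\<close>
    define w where "w = z ^ (4 * ?N + 1)"
    have "4 * ?N + 1 + 3 = n * 4" "2 * ?N + 2 = n * 2"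
      using n by simp_all
    then have "w * z ^ 3 = 1" and exp: "z ^ (2 * ?N + 2) = 1"
      unfolding w_def by (simp_all only: power_add[symmetric] power_mult z(1) power_one)
    then show "poly g z ^ 4 * (z * (z + 1) * (1 + z ^ (4 * ?N + 1)) - 4 * z ^ (2 * ?N + 2)) =
        (1 + 3 * z + z ^ 2) * (z ^ 2 * poly h z ^ 4 * (1 - z) ^ 2)"
      unfolding g4 exp w_def[symmetric] by algebra
  qed
qed

theorem theorem1p1:
  fixes n :: nat
  assumes "n > 1" and "odd n"
  shows "ratfun_cong
           (\<Sum>k=0..(n + 1) div 2. qint (4 * int k - 1) *
              (qshift (inverse qvar) (qvar ^ 2) k ^ 4 / qshift (qvar ^ 2) (qvar ^ 2) k ^ 4) *
              qvar ^ (4 * k))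
           (- (1 + 3 * qvar + qvar ^ 2) * qint (int n) ^ 4)
           (qint_poly n ^ 4 * cyclotomic n)
       \<and> ratfun_cong
           (\<Sum>k=0..n - 1. qint (4 * int k - 1) *
              (qshift (inverse qvar) (qvar ^ 2) k ^ 4 / qshift (qvar ^ 2) (qvar ^ 2) k ^ 4) *
              qvar ^ (4 * k))
           (- (1 + 3 * qvar + qvar ^ 2) * qint (int n) ^ 4)
           (qint_poly n ^ 4 * cyclotomic n)"
proof -
  obtain M where M: "n = 2 * M + 1"
    using \<open>odd n\<close> by (rule oddE)
  then have "M > 0" "(n + 1) div 2 = M + 1" "n - 1 = 2 * M"
    using \<open>n > 1\<close> by simp_all
  then show ?thesis
    using middle_sum_cong[OF M] full_sum_cong[OF M] by simp
qed

end
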